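(* Let $\varphi(z)=a+\lambda z$ with $a,\lambda\in\mathbb{C}$, $|\lambda-\tfrac12|\le\tfrac12$ and $\lambda\neq 0,1$, and let $\psi\in F^2$ be such that $$f_{\psi,\varphi}(w)=\frac1\lambda\, e^{\frac{\lambda-1}{\lambda}|w|^2+\frac{a\overline w}{\lambda}}\,\psi\!\left(\frac{w-a}{\lambda}\right)$$ is a bounded function of $w\in\mathbb{C}$. Then $W_{\psi,\varphi}=T_{f_{\psi,\varphi}}$ as operators on $F^2$.
   Context: $\mu$ is the Gaussian measure $d\mu(z)=\frac1\pi e^{-|z|^2}dz$ on $\mathbb{C}$, and $F^2=L^2(\mathbb{C},\mu)\cap\operatorname{Hol}(\mathbb{C})$ is the Fock space. Let $P$ be the orthogonal projection of $L^2(\mathbb{C},\mu)$ onto $F^2$; for $f\in L^\infty(\mathbb{C})$ the Toeplitz operator is $T_f g=P(fg)$, $g\in F^2$. For $\psi\in F^2$ and $\varphi$ entire, the weighted composition operator is $W_{\psi,\varphi}f=\psi\cdot(f\circ\varphi)$. *)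

theory Defs
  imports "HOL-Complex_Analysis.Complex_Analysis"
begin

definition gauss_measure :: "complex measure" where
  "gauss_measure = density lborel (\<lambda>z. ennreal (exp (- (cmod z)\<^sup>2) / pi))"

text \<open>Square integrable functions, not their classes modulo null sets. On the Fock space
  nothing is lost: two entire functions that agree almost everywhere are equal.\<close>

definition L2_gauss :: "(complex \<Rightarrow> complex) set" where
  "L2_gauss = {f \<in> borel_measurable gauss_measure. integrable gauss_measure (\<lambda>z. (cmod (f z))\<^sup>2)}"

definition L2_inner :: "(complex \<Rightarrow> complex) \<Rightarrow> (complex \<Rightarrow> complex) \<Rightarrow> complex" where
  "L2_inner f g = (\<integral>z. f z * cnj (g z) \<partial>gauss_measure)"

definition fock :: "(complex \<Rightarrow> complex) set" where
  "fock = L2_gauss \<inter> {f. f holomorphic_on UNIV}"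

text \<open>The orthogonal projection of \<open>L2_gauss\<close> onto \<open>fock\<close>: the value at \<open>g\<close> is the element
  \<open>h\<close> of \<open>fock\<close> for which \<open>g - h\<close> is orthogonal to \<open>fock\<close>. It is only meaningful
  for \<open>g \<in> L2_gauss\<close>.\<close>

definition fock_proj :: "(complex \<Rightarrow> complex) \<Rightarrow> (complex \<Rightarrow> complex)" where
  "fock_proj g = (THE h. h \<in> fock \<and> (\<forall>k\<in>fock. L2_inner (\<lambda>z. g z - h z) k = 0))"

text \<open>Only meaningful for essentially bounded measurable \<open>f\<close> and for \<open>g \<in> fock\<close>.\<close>

definition toeplitz :: "(complex \<Rightarrow> complex) \<Rightarrow> (complex \<Rightarrow> complex) \<Rightarrow> (complex \<Rightarrow> complex)" where
  "toeplitz f g = fock_proj (\<lambda>z. f z * g z)"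

definition weighted_comp ::
  "(complex \<Rightarrow> complex) \<Rightarrow> (complex \<Rightarrow> complex) \<Rightarrow> (complex \<Rightarrow> complex) \<Rightarrow> (complex \<Rightarrow> complex)" where
  "weighted_comp \<psi> \<phi> f = (\<lambda>z. \<psi> z * f (\<phi> z))"

text \<open>The symbol \<open>f\<^bsub>\<psi>,\<phi>\<^esub>\<close> for \<open>\<phi> z = a + l * z\<close>.\<close>

definition symbol :: "(complex \<Rightarrow> complex) \<Rightarrow> complex \<Rightarrow> complex \<Rightarrow> complex \<Rightarrow> complex" where
  "symbol \<psi> a l w =
     1 / l * exp ((l - 1) / l * complex_of_real ((cmod w)\<^sup>2) + a * cnj w / l) * \<psi> ((w - a) / l)"

end

theory Submission
  imports Defs
begin

text \<open>
  Put \<open>c = 1 / l\<close>, so \<open>Re c > 0\<close>. The Fock projection of \<open>u\<close> at \<open>z\<close> is the integral of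
  \<open>u w * exp (z * cnj w)\<close>, and for \<open>u = symbol \<psi> a l * g\<close> the integrand with respect to Lebesgue
  measure becomes \<open>c / pi * exp (- c * cnj w * (w - w0)) * G w\<close>, where \<open>w0 = a + l * z\<close> and
  \<open>G w = \<psi> ((w - a) / l) * g w\<close> is entire. Writing \<open>G w = G w0 + (w - w0) * Q w\<close> with \<open>Q\<close> entire,
  the second part integrates to \<open>0\<close>, since \<open>exp (- c * cnj w * (w - w0)) * (w - w0) * Q w\<close> is,
  up to the factor \<open>- c\<close>, the \<open>cnj w\<close>-derivative of \<open>exp (- c * cnj w * (w - w0)) * Q w\<close>. What remains is
  \<open>G w0 = \<psi> z * g (a + l * z)\<close>. The case \<open>c = 1\<close> is the reproducing property of the kernel, and
  square integrability of the kernel integral follows from the Schur test, because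
  the kernel times the Gaussian weights has modulus \<open>exp (- (cmod (z - w))\<^sup>2 / 2)\<close>.
\<close>

section \<open>Lebesgue measure in real coordinates and integrals of partial derivatives\<close>

lemma measurable_Complex_pair:
  "(\<lambda>(x, y). Complex x y) \<in> borel_measurable (lborel \<Otimes>\<^sub>M lborel)"
  unfolding lborel_prod case_prod_unfold Complex_eq measurable_lborel2
  by (intro borel_measurable_continuous_onI continuous_intros)

text \<open>Boxes determine Lebesgue measure, and the preimage of a box is a product of intervals.
  This makes Fubini available in the coordinates \<open>Re\<close> and \<open>Im\<close>.\<close>

lemma distr_lborel_Complex:
  "distr (lborel \<Otimes>\<^sub>M lborel) borel (\<lambda>(x, y). Complex x y) = lborel"
proof (rule lborel_eqI[symmetric])
  fix l u :: complex
  assume *: "\<And>b. b \<in> Basis \<Longrightarrow> l \<bullet> b \<le> u \<bullet> b"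
  have le: "Re l \<le> Re u" "Im l \<le> Im u"
    using *[of 1] *[of \<i>] by (auto simp: Basis_complex_def)
  have "(\<lambda>(x, y). Complex x y) -` box l u \<inter> space (lborel \<Otimes>\<^sub>M lborel)
      = box (Re l) (Re u) \<times> box (Im l) (Im u)"
    by (auto simp: box_def Basis_complex_def space_pair_measure)
  then show "emeasure (distr (lborel \<Otimes>\<^sub>M lborel) borel (\<lambda>(x, y). Complex x y)) (box l u)
      = ennreal (prod ((\<bullet>) (u - l)) Basis)"
    using le by (simp add: emeasure_distr[OF measurable_Complex_pair] lborel.emeasure_pair_measure_Times
        Basis_complex_def ennreal_mult)
qed simp

text \<open>On each horizontal line the fundamental theorem of calculus leaves only values of
  \<open>F\<close> at points where it vanishes, and Fubini then integrates zeros. Compact support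
  makes the continuous function \<open>Fx\<close> integrable.\<close>

lemma integral_partial_Re:
  fixes F Fx :: "complex \<Rightarrow> complex"
  assumes der: "\<And>x y. ((\<lambda>t. F (Complex t y)) has_vector_derivative Fx (Complex x y)) (at x)"
    and cont: "continuous_on UNIV Fx"
    and F0: "\<And>z. r \<le> cmod z \<Longrightarrow> F z = 0" and Fx0: "\<And>z. r \<le> cmod z \<Longrightarrow> Fx z = 0"
  shows "(\<integral>z. Fx z \<partial>lborel) = 0"
proof -
  \<comment> \<open>\<open>r\<close> may be negative, but the endpoints of \<open>{-R..R}\<close>
    must be in order.\<close>
  define R where "R = max r 0"
  have [measurable]: "Fx \<in> borel_measurable borel"
    using cont by (rule borel_measurable_continuous_onI)
  have int: "integrable lborel Fx"
  proof -
    have "integrable lborel (\<lambda>z. indicator (cball 0 R) z *\<^sub>R Fx z)"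
      by (intro borel_integrable_compact continuous_on_subset[OF cont]) auto
    moreover have "(\<lambda>z. indicator (cball 0 R) z *\<^sub>R Fx z) = Fx"
      using Fx0 by (auto simp: fun_eq_iff indicator_def R_def)
    ultimately show ?thesis by simp
  qed
  have inner: "(\<integral>x. Fx (Complex x y) \<partial>lborel) = 0" for y
  proof -
    have big: "r \<le> cmod (Complex x y)" if "R \<le> \<bar>x\<bar>" for x
      using that abs_Re_le_cmod[of "Complex x y"] by (simp add: R_def)
    have "(\<integral>x. Fx (Complex x y) \<partial>lborel) = (\<integral>x. indicator {-R..R} x *\<^sub>R Fx (Complex x y) \<partial>lborel)"
      by (intro Bochner_Integration.integral_cong) (auto simp: indicator_def intro!: Fx0 big)
    also have "\<dots> = F (Complex R y) - F (Complex (-R) y)"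
    proof (rule integral_FTC_Icc)
      show "continuous_on {-R..R} (\<lambda>x. Fx (Complex x y))"
        unfolding Complex_eq
        by (intro continuous_on_compose2[OF cont] continuous_intros) auto
    qed (use der in \<open>auto simp: R_def intro: has_vector_derivative_at_within\<close>)
    also have "\<dots> = 0"
      using F0 big by (simp add: R_def)
    finally show ?thesis .
  qed
  have int2: "integrable (lborel \<Otimes>\<^sub>M lborel) (\<lambda>(x, y). Fx (Complex x y))"
    using int measurable_Complex_pair
    by (subst (asm) distr_lborel_Complex[symmetric]) (simp add: integrable_distr_eq case_prod_unfold)
  have "(\<integral>z. Fx z \<partial>lborel) = (\<integral>(x, y). Fx (Complex x y) \<partial>(lborel \<Otimes>\<^sub>M lborel))"
    by (subst distr_lborel_Complex[symmetric])
       (subst integral_distr, use measurable_Complex_pair in \<open>auto simp: case_prod_unfold\<close>)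
  also have "\<dots> = (\<integral>y. (\<integral>x. Fx (Complex x y) \<partial>lborel) \<partial>lborel)"
    using lborel_pair.integral_snd[of "\<lambda>x y. Fx (Complex x y)"] int2 by simp
  also have "\<dots> = 0"
    by (simp add: inner)
  finally show ?thesis .
qed

text \<open>Reflection in the diagonal exchanges the coordinates and preserves both Lebesgue measure
  and the modulus, so the horizontal case applies.\<close>

lemma integral_partial_Im:
  fixes F Fy :: "complex \<Rightarrow> complex"
  assumes der: "\<And>x y. ((\<lambda>t. F (Complex x t)) has_vector_derivative Fy (Complex x y)) (at y)"
    and cont: "continuous_on UNIV Fy"
    and F0: "\<And>z. r \<le> cmod z \<Longrightarrow> F z = 0" and Fy0: "\<And>z. r \<le> cmod z \<Longrightarrow> Fy z = 0"
  shows "(\<integral>z. Fy z \<partial>lborel) = 0"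
proof -
  define s where "s z = Complex (Im z) (Re z)" for z
  have s_alt: "s = (\<lambda>z. \<i> * cnj z)"
    by (auto simp: s_def complex_eq_iff fun_eq_iff)
  have [measurable]: "Fy \<in> borel_measurable borel"
    using cont by (rule borel_measurable_continuous_onI)
  have [measurable]: "s \<in> borel_measurable borel"
    unfolding s_alt by (intro borel_measurable_continuous_onI continuous_intros)
  have "distr lborel borel s = lborel"
  proof (rule lborel_eqI[symmetric])
    fix l u :: complex
    assume *: "\<And>b. b \<in> Basis \<Longrightarrow> l \<bullet> b \<le> u \<bullet> b"
    have le: "Re l \<le> Re u" "Im l \<le> Im u"
      using *[of 1] *[of \<i>] by (auto simp: Basis_complex_def)
    have "s -` box l u = box (s l) (s u)"
      by (auto simp: box_def Basis_complex_def s_def)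
    then show "emeasure (distr lborel borel s) (box l u) = ennreal (prod ((\<bullet>) (u - l)) Basis)"
      using le by (simp add: emeasure_distr emeasure_lborel_box_eq Basis_complex_def s_def ac_simps)
  qed simp
  then have "(\<integral>z. Fy z \<partial>lborel) = (\<integral>z. Fy z \<partial>distr lborel borel s)"
    by simp
  also have "\<dots> = (\<integral>z. Fy (s z) \<partial>lborel)"
    by (rule integral_distr) auto
  also have "\<dots> = 0"
  proof (rule integral_partial_Re[where r = r])
    show "((\<lambda>t. F (s (Complex t y))) has_vector_derivative Fy (s (Complex x y))) (at x)" for x y
      using der by (simp add: s_def)
    show "continuous_on UNIV (\<lambda>z. Fy (s z))"
      unfolding s_alt by (intro continuous_on_compose2[OF cont] continuous_intros) auto
  qed (use F0 Fy0 in \<open>auto simp: s_alt norm_mult\<close>)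
  finally show ?thesis .
qed

section \<open>Gaussian integrals with a complex parameter\<close>

text \<open>A disc of radius \<open>sqrt t\<close> has area \<open>pi * t\<close>, and half-lines
  determine a measure on the reals. This takes the place of polar coordinates for radial
  integrands.\<close>

lemma distr_lborel_cmod_power2:
  "distr lborel borel (\<lambda>w. (cmod w)\<^sup>2) = density lborel (\<lambda>t. ennreal (pi * indicator {0..} t))"
    (is "?M = ?N")
proof (rule measure_eqI_generator_eq)
  show "Int_stable (range (\<lambda>a::real. {..a}))"
    by (auto simp: Int_stable_def)
  show "sets ?M = sigma_sets UNIV (range (\<lambda>a. {..a}))" "sets ?N = sigma_sets UNIV (range (\<lambda>a. {..a}))"
    by (simp_all add: borel_eq_atMost)
  have M: "emeasure ?M {..t} = ennreal (pi * max 0 t)" for t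
  proof -
    have "emeasure ?M {..t} = emeasure lborel {w::complex. (cmod w)\<^sup>2 \<le> t}"
      by (subst emeasure_distr) (auto simp: vimage_def)
    also have "\<dots> = ennreal (pi * max 0 t)"
    proof (cases "t \<ge> 0")
      case True
      have "{w::complex. (cmod w)\<^sup>2 \<le> t} = cball 0 (sqrt t)"
        using real_sqrt_le_iff[of "(cmod w)\<^sup>2" t for w] by (simp add: set_eq_iff)
      then show ?thesis
        using True by (simp add: emeasure_cball unit_ball_vol_2 mult.commute)
    next
      case False
      then have "{w::complex. (cmod w)\<^sup>2 \<le> t} = {}"
        by (auto simp: not_le intro: less_le_trans)
      then show ?thesis using False by simp
    qed
    finally show ?thesis .
  qed
  have N: "emeasure ?N {..t} = ennreal (pi * max 0 t)" for t
  proof -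
    have "emeasure ?N {..t} = (\<integral>\<^sup>+x. ennreal pi * indicator {0..t} x \<partial>lborel)"
      by (subst emeasure_density) (auto simp: indicator_def intro!: nn_integral_cong)
    also have "\<dots> = ennreal (pi * max 0 t)"
      by (subst nn_integral_cmult) (auto simp: ennreal_mult max_def)
    finally show ?thesis .
  qed
  show "emeasure ?M X = emeasure ?N X" if "X \<in> range (\<lambda>a. {..a})" for X
    using that M N by auto
  show "range (\<lambda>n::nat. {..real n}) \<subseteq> range (\<lambda>a. {..a})" by auto
  show "(\<Union>n::nat. {..real n}) = UNIV" using real_arch_simple by auto
  show "emeasure ?M {..real n} \<noteq> \<infinity>" for n by (simp add: M)
qed auto

text \<open>The modulus \<open>exp (- Re c * t)\<close> gives integrability. The value is the limit
  of the integrals over \<open>{0..y}\<close>, which the antiderivative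
  \<open>- (1/c) * exp (- c * t)\<close> computes.\<close>

lemma has_bochner_integral_exp_Ici:
  fixes c :: complex
  assumes "Re c > 0"
  shows "has_bochner_integral lborel (\<lambda>t. indicator {0..} t *\<^sub>R exp (- c * of_real t)) (1 / c)"
proof -
  have c: "c \<noteq> 0" using assms by auto
  have re: "integrable lborel (\<lambda>t::real. indicator {0..} t *\<^sub>R exp (- Re c * t))"
  proof -
    have "((\<lambda>t. exp (- Re c * t)) absolutely_integrable_on {0..})"
      using assms has_integral_exp_minus_to_infinity[of "Re c" 0]
      by (intro nonnegative_absolutely_integrable_1) (auto simp: has_integral_iff)
    then show ?thesis
      by (subst integrable_completion[symmetric]) (auto simp: set_integrable_def)
  qed
  have int: "integrable lborel (\<lambda>t. indicator {0..} t *\<^sub>R exp (- c * of_real t))"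
    by (rule Bochner_Integration.integrable_bound[OF re]) (auto simp: indicator_def)
  have lim1: "((\<lambda>y. \<integral>t. indicator {..y} t *\<^sub>R (indicator {0..} t *\<^sub>R exp (- c * of_real t)) \<partial>lborel)
      \<longlongrightarrow> (\<integral>t. indicator {0..} t *\<^sub>R exp (- c * of_real t) \<partial>lborel)) at_top"
    by (rule tendsto_integral_at_top[OF _ int]) simp
  have "eventually (\<lambda>y. (\<integral>t. indicator {..y} t *\<^sub>R (indicator {0..} t *\<^sub>R exp (- c * of_real t)) \<partial>lborel)
      = - (1/c) * exp (- c * of_real y) + 1 / c) at_top"
    using eventually_ge_at_top[of 0]
  proof eventually_elim
    case (elim y)
    have "(\<integral>t. indicator {..y} t *\<^sub>R (indicator {0..} t *\<^sub>R exp (- c * of_real t)) \<partial>lborel)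
        = (\<integral>t. indicator {0..y} t *\<^sub>R exp (- c * of_real t) \<partial>lborel)"
      by (intro Bochner_Integration.integral_cong) (auto simp: indicator_def)
    also have "\<dots> = - (1/c) * exp (- c * of_real y) - (- (1/c) * exp (- c * of_real 0))"
    proof (rule integral_FTC_Icc[OF elim])
      show "((\<lambda>t. - (1/c) * exp (- c * of_real t)) has_vector_derivative exp (- c * of_real t)) (at t within {0..y})" for t
      proof (rule has_vector_derivative_real_field)
        show "((\<lambda>z. - (1/c) * exp (- c * z)) has_field_derivative exp (- c * of_real t)) (at (of_real t))"
          using c by (auto intro!: derivative_eq_intros)
      qed
    qed (intro continuous_intros)
    finally show ?case by simp
  qed
  moreover have "((\<lambda>y. - (1/c) * exp (- c * of_real y) + 1 / c) \<longlongrightarrow> - (1/c) * 0 + 1 / c) at_top"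
  proof (intro tendsto_intros)
    have "((\<lambda>y. exp (- Re c * y)) \<longlongrightarrow> 0) at_top"
      using assms by real_asymp
    then show "((\<lambda>y. exp (- c * of_real y)) \<longlongrightarrow> 0) at_top"
      by (subst tendsto_norm_zero_iff[symmetric]) simp
  qed
  ultimately have "((\<lambda>y. \<integral>t. indicator {..y} t *\<^sub>R (indicator {0..} t *\<^sub>R exp (- c * of_real t)) \<partial>lborel)
      \<longlongrightarrow> 1 / c) at_top"
    by (simp add: filterlim_cong)
  with lim1 have "(\<integral>t. indicator {0..} t *\<^sub>R exp (- c * of_real t) \<partial>lborel) = 1 / c"
    by (intro tendsto_unique[OF _ lim1]) auto
  with int show ?thesis by (simp add: has_bochner_integral_iff)
qed

text \<open>The substitution \<open>t = (cmod w)\<^sup>2\<close> reduces this to \<open>pi\<close>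
  times the half-line integral of \<open>exp (- c * t)\<close>.\<close>

lemma has_bochner_integral_gauss:
  fixes c :: complex
  assumes "Re c > 0"
  shows "has_bochner_integral lborel (\<lambda>w. exp (- c * of_real ((cmod w)\<^sup>2))) (pi / c)"
proof -
  let ?g = "\<lambda>t::real. exp (- c * of_real t)"
  have [measurable]: "?g \<in> borel_measurable borel"
    by (intro borel_measurable_continuous_onI continuous_intros)
  have "has_bochner_integral lborel (\<lambda>t. pi *\<^sub>R (indicator {0..} t *\<^sub>R ?g t)) (pi *\<^sub>R (1 / c))"
    by (intro has_bochner_integral_scaleR_right has_bochner_integral_exp_Ici assms)
  then have "has_bochner_integral lborel (\<lambda>t. (pi * indicator {0..} t) *\<^sub>R ?g t) (pi / c)"
    by (simp add: scaleR_conv_of_real mult.assoc)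
  then have "has_bochner_integral (density lborel (\<lambda>t. ennreal (pi * indicator {0..} t))) ?g (pi / c)"
    by (intro has_bochner_integral_density) auto
  then show ?thesis
    unfolding distr_lborel_cmod_power2[symmetric] has_bochner_integral_iff
    by (simp add: integrable_distr_eq integral_distr)
qed

section \<open>Vanishing of the integral of a \<open>cnj w\<close>-derivative\<close>

text \<open>Squaring smooths the corner of \<open>max 0 t\<close> at 0, where the difference
  quotient is \<open>max 0 h\<close>. A cutoff with one continuous derivative is all that the
  integration by parts asks for.\<close>

lemma has_real_derivative_max_0_power2:
  fixes t :: real
  shows "((\<lambda>t. (max 0 t)\<^sup>2) has_real_derivative 2 * max 0 t) (at t)"
proof (cases t "0 :: real" rule: linorder_cases)
  case less
  have "((\<lambda>t. 0) has_real_derivative 2 * max 0 t) (at t)"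
    using less by simp
  then show ?thesis
    by (rule has_field_derivative_transform_within_open[where S = "{..<0}"]) (use less in auto)
next
  case greater
  have "((\<lambda>t. t\<^sup>2) has_real_derivative 2 * max 0 t) (at t)"
    using greater by (auto intro!: derivative_eq_intros)
  then show ?thesis
    by (rule has_field_derivative_transform_within_open[where S = "{0<..}"]) (use greater in auto)
next
  case equal
  have "((\<lambda>h::real. max 0 h) \<longlongrightarrow> max 0 0) (at 0)"
    by (intro tendsto_intros)
  moreover have "(max 0 h)\<^sup>2 / h = max 0 h" for h :: real
    by (simp add: max_def power2_eq_square)
  ultimately show ?thesis
    using equal by (simp add: DERIV_def)
qed

text \<open>The integrand is a multiple of a \<open>cnj w\<close>-derivative; the integral of that derivative is
  localised by the continuously differentiable cutoff \<open>X n\<close>, whose gradient is \<open>O(1/n)\<close>.\<close>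

lemma integral_gauss_twist_times_diff_eq_0:
  fixes Q :: "complex \<Rightarrow> complex" and c w0 :: complex
  defines "E \<equiv> \<lambda>w. exp (- c * cnj w * (w - w0)) * Q w"
  assumes c: "c \<noteq> 0" and Q: "Q holomorphic_on UNIV" and int: "integrable lborel (\<lambda>w. (w - w0) * E w)"
  shows "(\<integral>w. (w - w0) * E w \<partial>lborel) = 0"
proof -
  \<comment> \<open>\<open>X n\<close> is supported in the disc of radius \<open>n\<close> and tends
    to 1 pointwise; its root \<open>m n\<close> appears in its gradient. At \<open>n = 0\<close>
    division by zero makes both constantly 1, so \<open>key\<close> is stated for
    \<open>n > 0\<close>.\<close>
  define X where "X n w = (max 0 (1 - (cmod w)\<^sup>2 / (real n)\<^sup>2))\<^sup>2" for n :: nat and w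
  define m where "m n w = max 0 (1 - (cmod w)\<^sup>2 / (real n)\<^sup>2)" for n :: nat and w
  have contQ: "continuous_on UNIV Q"
    using Q by (rule holomorphic_on_imp_continuous_on)
  have contQ': "continuous_on UNIV (deriv Q)"
    using Q by (intro holomorphic_on_imp_continuous_on holomorphic_deriv) auto
  have Qd: "(Q has_field_derivative deriv Q w) (at w)" for w
    using Q by (intro holomorphic_derivI) auto
  have contE: "continuous_on UNIV E"
    unfolding E_def by (intro continuous_intros contQ)
  have [measurable]: "E \<in> borel_measurable borel" "Q \<in> borel_measurable borel"
    using contE contQ by (auto intro!: borel_measurable_continuous_onI)
  \<comment> \<open>On the unit disc about \<open>w0\<close> continuity bounds \<open>E\<close>;
    outside it \<open>cmod (w - w0)\<close> exceeds 1, so the integrable function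
    \<open>(w - w0) * E w\<close> dominates. The error term below is controlled by this
    integral.\<close>
  have intE: "integrable lborel E"
  proof -
    have "integrable lborel (\<lambda>w. indicator (cball w0 1) w *\<^sub>R E w)"
      by (intro borel_integrable_compact continuous_on_subset[OF contE]) auto
    then have "integrable lborel (\<lambda>w. norm (indicator (cball w0 1) w *\<^sub>R E w) + norm ((w - w0) * E w))"
      using int by (intro Bochner_Integration.integrable_add integrable_norm)
    then show ?thesis
    proof (rule Bochner_Integration.integrable_bound)
      show "AE w in lborel. norm (E w)
          \<le> norm (norm (indicator (cball w0 1) w *\<^sub>R E w) + norm ((w - w0) * E w))"
      proof (rule AE_I2)
        fix w
        have "norm (E w) \<le> norm ((w - w0) * E w)" if "w \<notin> cball w0 1"
          using that mult_right_mono[of 1 "norm (w - w0)" "norm (E w)"]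
          by (simp add: norm_mult dist_norm norm_minus_commute)
        then show "norm (E w)
          \<le> norm (norm (indicator (cball w0 1) w *\<^sub>R E w) + norm ((w - w0) * E w))"
          by (cases "w \<in> cball w0 1") auto
      qed
    qed simp
  qed
  \<comment> \<open>Integration by parts: \<open>Fx + \<i> * Fy\<close> is twice the
    \<open>cnj w\<close>-derivative of \<open>X n * E\<close> and integrates to 0. Differentiating
    \<open>E\<close> contributes \<open>- 2 * c * (w - w0) * E w\<close>, and differentiating the
    cutoff contributes \<open>- 4 * m n w * w / (real n)\<^sup>2\<close>.\<close>
  have key: "(\<integral>w. X n w *\<^sub>R ((w - w0) * E w) \<partial>lborel)
      = - (2 / c) * (\<integral>w. (m n w / (real n)\<^sup>2) *\<^sub>R (w * E w) \<partial>lborel)" if n: "n > 0" for n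
  proof -
    have solve: "x = - (2 / c) * y" if "- 2 * c * x - 4 * y = 0" for x y
    proof -
      have "c * x = - 2 * y" using that by algebra
      then show ?thesis using c by (simp add: field_simps)
    qed
    \<comment> \<open>\<open>Ex\<close> and \<open>Ey\<close> are the partial derivatives of
      \<open>E\<close>; \<open>Fx\<close> and \<open>Fy\<close> are those of the compactly supported
      product \<open>X n * E\<close>.\<close>
    define Ex where "Ex w = - c * ((w - w0) + cnj w) * E w
        + exp (- c * cnj w * (w - w0)) * deriv Q w" for w
    define Ey where "Ey w = - c * (- \<i> * (w - w0) + \<i> * cnj w) * E w
        + \<i> * exp (- c * cnj w * (w - w0)) * deriv Q w" for w
    define Fx where "Fx w = of_real (X n w) * Ex w - of_real (4 * m n w * Re w / (real n)\<^sup>2) * E w" for w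
    define Fy where "Fy w = of_real (X n w) * Ey w - of_real (4 * m n w * Im w / (real n)\<^sup>2) * E w" for w
    have contX: "continuous_on UNIV (\<lambda>w. X n w)" "continuous_on UNIV (\<lambda>w. m n w)"
      unfolding X_def m_def by (intro continuous_intros; use n in simp)+
    have contF: "continuous_on UNIV Fx" "continuous_on UNIV Fy"
      unfolding Fx_def Fy_def Ex_def Ey_def
      by (intro continuous_intros contX contE contQ'; use n in simp)+
    have zero: "X n w = 0" "m n w = 0" if "cmod w \<ge> real n" for w
      using that power_mono[of "real n" "cmod w" 2] n by (auto simp: X_def m_def max_def divide_simps)
    have Re: "(\<integral>w. Fx w \<partial>lborel) = 0"
    proof (rule integral_partial_Re[where F = "\<lambda>w. of_real (X n w) * E w" and r = n])
      fix x y
      show "((\<lambda>t. of_real (X n (Complex t y)) * E (Complex t y)) has_vector_derivative Fx (Complex x y)) (at x)"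
      proof -
        have "((\<lambda>t. (max 0 (1 - (t\<^sup>2 + y\<^sup>2) / (real n)\<^sup>2))\<^sup>2) has_real_derivative
            2 * m n (Complex x y) * (- 2 * x / (real n)\<^sup>2)) (at x)"
          unfolding m_def cmod_power2 complex.sel
          by (rule DERIV_chain2[OF has_real_derivative_max_0_power2])
             (use n in \<open>auto intro!: derivative_eq_intros simp: field_simps\<close>)
        then have 1: "((\<lambda>t. complex_of_real (X n (Complex t y))) has_vector_derivative
            of_real (2 * m n (Complex x y) * (- 2 * x / (real n)\<^sup>2))) (at x)"
          unfolding X_def cmod_power2 complex.sel
          by (intro has_vector_derivative_of_real) (simp add: has_real_derivative_iff_has_vector_derivative)
        \<comment> \<open>On the line of height \<open>y\<close>, the conjugate of
          \<open>s + \<i> * y\<close> for real \<open>s\<close> is \<open>s - \<i> * y\<close>,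
          which is holomorphic in \<open>s\<close>. Complex differentiation therefore applies before
          restricting to real \<open>s\<close>; the vertical case below uses
          \<open>x + \<i> * s\<close> and \<open>x - \<i> * s\<close>.\<close>
        have "((\<lambda>s. exp (- c * (s - \<i> * y) * (s + \<i> * y - w0)) * Q (s + \<i> * y))
            has_field_derivative Ex (Complex x y)) (at (of_real x))"
          unfolding Ex_def E_def Complex_eq
          by (rule derivative_eq_intros DERIV_chain2[OF Qd] refl | simp add: algebra_simps)+
        then have "((\<lambda>t. exp (- c * (of_real t - \<i> * y) * (of_real t + \<i> * y - w0)) * Q (of_real t + \<i> * y))
            has_vector_derivative Ex (Complex x y)) (at x)"
          by (rule has_vector_derivative_real_field)
        then have 2: "((\<lambda>t. E (Complex t y)) has_vector_derivative Ex (Complex x y)) (at x)"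
          unfolding E_def Complex_eq by simp
        from has_vector_derivative_mult[OF 1 2] show ?thesis
          by (simp add: Fx_def mult.assoc)
      qed
    qed (use contF zero in \<open>auto simp: Fx_def\<close>)
    have Im: "(\<integral>w. Fy w \<partial>lborel) = 0"
    proof (rule integral_partial_Im[where F = "\<lambda>w. of_real (X n w) * E w" and r = n])
      fix x y
      show "((\<lambda>t. of_real (X n (Complex x t)) * E (Complex x t)) has_vector_derivative Fy (Complex x y)) (at y)"
      proof -
        have "((\<lambda>t. (max 0 (1 - (x\<^sup>2 + t\<^sup>2) / (real n)\<^sup>2))\<^sup>2) has_real_derivative
            2 * m n (Complex x y) * (- 2 * y / (real n)\<^sup>2)) (at y)"
          unfolding m_def cmod_power2 complex.sel
          by (rule DERIV_chain2[OF has_real_derivative_max_0_power2])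
             (use n in \<open>auto intro!: derivative_eq_intros simp: field_simps\<close>)
        then have 1: "((\<lambda>t. complex_of_real (X n (Complex x t))) has_vector_derivative
            of_real (2 * m n (Complex x y) * (- 2 * y / (real n)\<^sup>2))) (at y)"
          unfolding X_def cmod_power2 complex.sel
          by (intro has_vector_derivative_of_real) (simp add: has_real_derivative_iff_has_vector_derivative)
        have "((\<lambda>s. exp (- c * (x - \<i> * s) * (x + \<i> * s - w0)) * Q (x + \<i> * s))
            has_field_derivative Ey (Complex x y)) (at (of_real y))"
          unfolding Ey_def E_def Complex_eq
          by (rule derivative_eq_intros DERIV_chain2[OF Qd] refl | simp add: algebra_simps)+
        then have "((\<lambda>t. exp (- c * (x - \<i> * of_real t) * (x + \<i> * of_real t - w0)) * Q (x + \<i> * of_real t))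
            has_vector_derivative Ey (Complex x y)) (at y)"
          by (rule has_vector_derivative_real_field)
        then have 2: "((\<lambda>t. E (Complex x t)) has_vector_derivative Ey (Complex x y)) (at y)"
          unfolding E_def Complex_eq by simp
        from has_vector_derivative_mult[OF 1 2] show ?thesis
          by (simp add: Fy_def mult.assoc)
      qed
    qed (use contF zero in \<open>auto simp: Fy_def\<close>)
    have supp: "integrable lborel f" if "continuous_on UNIV f" "\<And>w. cmod w \<ge> real n \<Longrightarrow> f w = 0"
      for f :: "complex \<Rightarrow> complex"
    proof -
      have "integrable lborel (\<lambda>w. indicator (cball 0 (real n)) w *\<^sub>R f w)"
        by (intro borel_integrable_compact continuous_on_subset[OF that(1)]) auto
      moreover have "(\<lambda>w. indicator (cball 0 (real n)) w *\<^sub>R f w) = f"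
        using that(2) by (auto simp: fun_eq_iff indicator_def)
      ultimately show ?thesis by simp
    qed
    have "integrable lborel Fx" "integrable lborel Fy"
      using contF zero by (auto intro!: supp simp: Fx_def Fy_def)
    then have "(\<integral>w. Fx w + \<i> * Fy w \<partial>lborel) = 0"
      using Re Im by simp
    also have "(\<lambda>w. Fx w + \<i> * Fy w)
        = (\<lambda>w. - 2 * c * (X n w *\<^sub>R ((w - w0) * E w)) - 4 * ((m n w / (real n)\<^sup>2) *\<^sub>R (w * E w)))"
    proof
      fix w
      have ring: "(X * p - a * r * e) + \<i> * (X * q - a * s * e) = X * (p + \<i> * q) - a * (r + \<i> * s) * e"
        for X p a r e q s :: complex
        by (simp add: algebra_simps)
      have ring2: "- c * (d + d') * e + x * q + \<i> * (- c * (- \<i> * d + \<i> * d') * e + \<i> * x * q)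
          = - 2 * c * d * e" for d d' e x q :: complex
        by (simp add: algebra_simps)
      have ring3: "X * (- 2 * c * d * e) - 4 * r * w * e = - 2 * c * (X * (d * e)) - 4 * (r * (w * e))"
        for X d e r :: complex
        by (simp add: algebra_simps)
      have split2: "complex_of_real (4 * m n w / (real n)\<^sup>2) = 4 * of_real (m n w / (real n)\<^sup>2)"
        by simp
      have split: "complex_of_real (4 * m n w * t / (real n)\<^sup>2) = of_real (4 * m n w / (real n)\<^sup>2) * of_real t" for t
        by simp
      have "Fx w + \<i> * Fy w = of_real (X n w) * (Ex w + \<i> * Ey w)
          - of_real (4 * m n w / (real n)\<^sup>2) * (of_real (Re w) + \<i> * of_real (Im w)) * E w"
        unfolding Fx_def Fy_def split ring ..
      \<comment> \<open>By the Cauchy-Riemann equations the contributions of \<open>Q\<close> and of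
        the factor \<open>w - w0\<close> in the exponent cancel; the factor \<open>cnj w\<close>
        contributes twice.\<close>
      also have "Ex w + \<i> * Ey w = - 2 * c * (w - w0) * E w"
        unfolding Ex_def Ey_def by (rule ring2)
      also have "of_real (Re w) + \<i> * of_real (Im w) = w"
        by (rule complex_eq[symmetric])
      finally show "Fx w + \<i> * Fy w
          = - 2 * c * (X n w *\<^sub>R ((w - w0) * E w)) - 4 * ((m n w / (real n)\<^sup>2) *\<^sub>R (w * E w))"
        unfolding scaleR_conv_of_real split2 ring3 .
    qed
    also have "(\<integral>w. - 2 * c * (X n w *\<^sub>R ((w - w0) * E w)) - 4 * ((m n w / (real n)\<^sup>2) *\<^sub>R (w * E w)) \<partial>lborel)
        = - 2 * c * (\<integral>w. X n w *\<^sub>R ((w - w0) * E w) \<partial>lborel)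
          - 4 * (\<integral>w. (m n w / (real n)\<^sup>2) *\<^sub>R (w * E w) \<partial>lborel)"
    proof -
      have i1: "integrable lborel (\<lambda>w. X n w *\<^sub>R ((w - w0) * E w))"
        using zero by (intro supp continuous_intros contX contE) auto
      have i2: "integrable lborel (\<lambda>w. (m n w / (real n)\<^sup>2) *\<^sub>R (w * E w))"
        using zero n by (intro supp continuous_intros contX contE) auto
      show ?thesis
        using Bochner_Integration.integral_diff[OF integrable_mult_right[OF i1, of "- 2 * c"] integrable_mult_right[OF i2, of 4]]
        by (simp only: integral_mult_right_zero)
    qed
    finally show ?thesis by (rule solve)
  qed
  have m01: "0 \<le> m n w" "m n w \<le> 1" for n w
    by (auto simp: m_def)
  have X01: "0 \<le> X n w" "X n w \<le> 1" for n w
    using m01[of n w] by (auto simp: X_def m_def[symmetric] power_le_one)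
  have [measurable]: "X n \<in> borel_measurable borel" "m n \<in> borel_measurable borel" for n
    unfolding X_def m_def by measurable
  have lim1: "(\<lambda>n. \<integral>w. X n w *\<^sub>R ((w - w0) * E w) \<partial>lborel) \<longlonglongrightarrow> (\<integral>w. (w - w0) * E w \<partial>lborel)"
  proof (rule integral_dominated_convergence[where w = "\<lambda>w. norm ((w - w0) * E w)"])
    show "AE w in lborel. (\<lambda>n. X n w *\<^sub>R ((w - w0) * E w)) \<longlonglongrightarrow> (w - w0) * E w"
    proof (rule AE_I2)
      fix w
      have "(\<lambda>n. X n w) \<longlonglongrightarrow> (max 0 (1 - 0))\<^sup>2"
        unfolding X_def
        by (intro tendsto_intros real_tendsto_divide_at_top[OF tendsto_const]) real_asymp
      then show "(\<lambda>n. X n w *\<^sub>R ((w - w0) * E w)) \<longlonglongrightarrow> (w - w0) * E w"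
        by (auto intro: tendsto_eq_intros)
    qed
    show "AE w in lborel. norm (X n w *\<^sub>R ((w - w0) * E w)) \<le> norm ((w - w0) * E w)" for n
      using X01 by (intro AE_I2) (auto intro!: mult_left_le_one_le)
  qed (use int in auto)
  have lim2: "(\<lambda>n. \<integral>w. (m n w / (real n)\<^sup>2) *\<^sub>R (w * E w) \<partial>lborel) \<longlonglongrightarrow> 0"
  proof (rule Lim_null_comparison)
    have "(\<lambda>n. 1 / real n) \<longlonglongrightarrow> 0" by real_asymp
    from tendsto_mult_right_zero[OF this]
    show "(\<lambda>n. (\<integral>w. norm (E w) \<partial>lborel) * (1 / real n)) \<longlonglongrightarrow> 0" .
    show "eventually (\<lambda>n. norm (\<integral>w. (m n w / (real n)\<^sup>2) *\<^sub>R (w * E w) \<partial>lborel)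
        \<le> (\<integral>w. norm (E w) \<partial>lborel) * (1 / real n)) sequentially"
      using eventually_gt_at_top[of 0]
    proof eventually_elim
      case (elim n)
      \<comment> \<open>Since \<open>m n\<close> is at most 1 and vanishes for
        \<open>cmod w > n\<close>, the factor \<open>m n w * cmod w / (real n)\<^sup>2\<close> is at
        most \<open>1 / n\<close>.\<close>
      have bound: "norm ((m n w / (real n)\<^sup>2) *\<^sub>R (w * E w)) \<le> norm (E w) * (1 / real n)" for w
      proof (cases "cmod w \<le> n")
        case True
        have "m n w / (real n)\<^sup>2 * cmod w \<le> 1 / (real n)\<^sup>2 * real n"
          using m01[of n w] True by (intro mult_mono divide_right_mono) auto
        also have "\<dots> = 1 / real n" by (simp add: power2_eq_square)
        finally have "m n w / (real n)\<^sup>2 * cmod w * norm (E w) \<le> 1 / real n * norm (E w)"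
          by (rule mult_right_mono) simp
        then show ?thesis using m01[of n w] by (simp add: norm_mult mult_ac)
      next
        case False
        then have "m n w = 0"
          using power_mono[of "real n" "cmod w" 2] elim by (auto simp: m_def max_def divide_simps)
        then show ?thesis by simp
      qed
      have i: "integrable lborel (\<lambda>w. norm (E w) * (1 / real n))"
        by (intro integrable_mult_left integrable_norm intE)
      have "integrable lborel (\<lambda>w. (m n w / (real n)\<^sup>2) *\<^sub>R (w * E w))"
        by (rule Bochner_Integration.integrable_bound[OF i]) (use bound in \<open>auto simp del: norm_scaleR\<close>)
      then have "norm (\<integral>w. (m n w / (real n)\<^sup>2) *\<^sub>R (w * E w) \<partial>lborel)
          \<le> (\<integral>w. norm (E w) * (1 / real n) \<partial>lborel)"
        using i bound by (intro Bochner_Integration.integral_norm_bound_integral)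
      then show ?case by (simp add: intE)
    qed
  qed
  have "(\<lambda>n. \<integral>w. X n w *\<^sub>R ((w - w0) * E w) \<partial>lborel) \<longlonglongrightarrow> - (2 / c) * 0"
  proof (rule Lim_transform_eventually[OF tendsto_mult[OF tendsto_const lim2]])
    show "\<forall>\<^sub>F n in sequentially. - (2 / c) * (\<integral>w. (m n w / (real n)\<^sup>2) *\<^sub>R (w * E w) \<partial>lborel)
        = (\<integral>w. X n w *\<^sub>R ((w - w0) * E w) \<partial>lborel)"
      using eventually_gt_at_top[of 0] by (rule eventually_mono) (simp only: key)
  qed
  from LIMSEQ_unique[OF lim1 this] show ?thesis
    by simp
qed

section \<open>Twisted Gaussians against entire functions\<close>

text \<open>The zero of \<open>G w - G w0\<close> at \<open>w0\<close> can be divided out: the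
  difference quotient, completed by \<open>deriv G w0\<close>, is entire.\<close>

lemma integral_gauss_twist_diff_eq_0:
  fixes G :: "complex \<Rightarrow> complex" and c w0 :: complex
  assumes c: "c \<noteq> 0" and G: "G holomorphic_on UNIV"
    and int: "integrable lborel (\<lambda>w. exp (- c * cnj w * (w - w0)) * (G w - G w0))"
  shows "(\<integral>w. exp (- c * cnj w * (w - w0)) * (G w - G w0) \<partial>lborel) = 0"
proof -
  define Q where "Q = (\<lambda>w. if w = w0 then deriv G w0 else (G w - G w0) / (w - w0))"
  have Q: "Q holomorphic_on UNIV"
    unfolding Q_def using G by (rule pole_lemma) simp
  have eq: "(w - w0) * (exp (- c * cnj w * (w - w0)) * Q w)
      = exp (- c * cnj w * (w - w0)) * (G w - G w0)" for w
    by (simp add: Q_def)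
  show ?thesis
    by (rule integral_gauss_twist_times_diff_eq_0[OF c Q, of w0, unfolded eq, OF int])
qed

lemma norm_exp_gauss_twist:
  "cmod (exp (- c * cnj w * (w - w0))) = exp (- Re c * (cmod w)\<^sup>2 + Re (c * w0 * cnj w))"
proof -
  have "- c * cnj w * (w - w0) = - c * of_real ((cmod w)\<^sup>2) + c * w0 * cnj w"
    by (simp only: complex_norm_square) (simp add: algebra_simps)
  then show ?thesis by (simp del: of_real_power)
qed

text \<open>The quadratic decay absorbs the linear term: completing the square gives \<open>b * cmod
  w \<le> b\<^sup>2 / (2 * r) + r / 2 * (cmod w)\<^sup>2\<close>, which leaves a Gaussian of half
  the rate.\<close>

lemma integrable_gauss_twist:
  fixes c w0 :: complex
  assumes "Re c > 0"
  shows "integrable lborel (\<lambda>w. exp (- c * cnj w * (w - w0)))"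
proof -
  define r b where "r = Re c" and "b = cmod (c * w0)"
  have r: "r > 0" using assms by (simp add: r_def)
  have "integrable lborel (\<lambda>w::complex. exp (- complex_of_real (r / 2) * of_real ((cmod w)\<^sup>2)))"
    using has_bochner_integral_gauss[of "of_real (r / 2)"] r by (simp add: has_bochner_integral_iff)
  then have "integrable lborel (\<lambda>w::complex. exp (b\<^sup>2 / (2 * r)) * norm (exp (- complex_of_real (r / 2) * of_real ((cmod w)\<^sup>2))))"
    by (intro integrable_mult_right integrable_norm)
  then show ?thesis
  proof (rule Bochner_Integration.integrable_bound)
    show "(\<lambda>w. exp (- c * cnj w * (w - w0))) \<in> borel_measurable lborel"
      unfolding measurable_lborel2 by (intro borel_measurable_continuous_onI continuous_intros)
    show "AE w in lborel. norm (exp (- c * cnj w * (w - w0))) \<le> norm (exp (b\<^sup>2 / (2 * r)) * norm (exp (- complex_of_real (r / 2) * of_real ((cmod w)\<^sup>2))))"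
    proof (rule AE_I2)
      fix w
      have "Re (c * w0 * cnj w) \<le> b * cmod w"
        using complex_Re_le_cmod[of "c * w0 * cnj w"] by (simp add: b_def norm_mult)
      moreover have "0 \<le> (b - r * cmod w)\<^sup>2 / (2 * r)"
        using r by simp
      then have "b * cmod w \<le> b\<^sup>2 / (2 * r) + r / 2 * (cmod w)\<^sup>2"
        using r by (simp add: field_simps power2_eq_square)
      ultimately have "- Re c * (cmod w)\<^sup>2 + Re (c * w0 * cnj w) \<le> b\<^sup>2 / (2 * r) + - (r / 2) * (cmod w)\<^sup>2"
        by (simp add: r_def)
      then show "norm (exp (- c * cnj w * (w - w0))) \<le> norm (exp (b\<^sup>2 / (2 * r)) * norm (exp (- complex_of_real (r / 2) * of_real ((cmod w)\<^sup>2))))"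
        unfolding norm_exp_gauss_twist by (simp add: exp_add[symmetric] del: of_real_power)
    qed
  qed
qed

lemma integral_gauss_twist_1:
  fixes c w0 :: complex
  assumes "Re c > 0"
  shows "(\<integral>w. exp (- c * cnj w * (w - w0)) \<partial>lborel) = pi / c"
proof -
  \<comment> \<open>The conjugate of the difference from the centred Gaussian has the shape of the
    previous lemmas, now centred at \<open>0\<close>.\<close>
  define b where "b = cnj (c * w0)"
  have sq: "of_real ((cmod w)\<^sup>2) = w * cnj w" for w
    by (rule complex_norm_square)
  have eq: "exp (- c * cnj w * (w - w0)) - exp (- c * of_real ((cmod w)\<^sup>2))
      = cnj (exp (- cnj c * cnj w * (w - 0)) * (exp (b * w) - exp (b * 0)))" for w
    unfolding sq b_def by (simp add: exp_cnj algebra_simps exp_add[symmetric])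
  have gi: "integrable lborel (\<lambda>w::complex. exp (- c * of_real ((cmod w)\<^sup>2)))"
    and g: "(\<integral>w. exp (- c * of_real ((cmod (w::complex))\<^sup>2)) \<partial>lborel) = pi / c"
    using has_bochner_integral_gauss[OF assms] by (auto simp: has_bochner_integral_iff)
  have diff: "integrable lborel (\<lambda>w. exp (- c * cnj w * (w - w0)) - exp (- c * of_real ((cmod w)\<^sup>2)))"
    by (intro Bochner_Integration.integrable_diff integrable_gauss_twist assms gi)
  have "(\<integral>w. exp (- cnj c * cnj w * (w - 0)) * (exp (b * w) - exp (b * 0)) \<partial>lborel) = 0"
  proof (rule integral_gauss_twist_diff_eq_0)
    show "integrable lborel (\<lambda>w. exp (- cnj c * cnj w * (w - 0)) * (exp (b * w) - exp (b * 0)))"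
      using diff unfolding eq complex_integrable_cnj .
  qed (use assms in \<open>auto intro!: holomorphic_intros\<close>)
  then have "(\<integral>w. exp (- c * cnj w * (w - w0)) - exp (- c * of_real ((cmod w)\<^sup>2)) \<partial>lborel) = 0"
    unfolding eq Bochner_Integration.integral_cnj by (simp only: complex_cnj_zero)
  then show ?thesis
    using Bochner_Integration.integral_diff[OF integrable_gauss_twist[OF assms] gi, of w0] g by simp
qed

text \<open>The constant part \<open>G w0\<close> is integrable against the twisted Gaussian, so
  integrability passes to \<open>G w - G w0\<close>, whose integral vanishes.\<close>

lemma integral_gauss_twist:
  fixes G :: "complex \<Rightarrow> complex" and c w0 :: complex
  assumes c: "Re c > 0" and G: "G holomorphic_on UNIV"
    and int: "integrable lborel (\<lambda>w. exp (- c * cnj w * (w - w0)) * G w)"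
  shows "(\<integral>w. exp (- c * cnj w * (w - w0)) * G w \<partial>lborel) = pi / c * G w0"
proof -
  have int1: "integrable lborel (\<lambda>w. exp (- c * cnj w * (w - w0)) * G w0)"
    by (intro integrable_mult_left integrable_gauss_twist c)
  have "(\<integral>w. exp (- c * cnj w * (w - w0)) * (G w - G w0) \<partial>lborel) = 0"
  proof (rule integral_gauss_twist_diff_eq_0)
    show "integrable lborel (\<lambda>w. exp (- c * cnj w * (w - w0)) * (G w - G w0))"
      using Bochner_Integration.integrable_diff[OF int int1] by (simp add: algebra_simps)
  qed (use c G in auto)
  then have "(\<integral>w. exp (- c * cnj w * (w - w0)) * G w \<partial>lborel)
      = (\<integral>w. exp (- c * cnj w * (w - w0)) * G w0 \<partial>lborel)"
    using Bochner_Integration.integral_diff[OF int int1] by (simp add: algebra_simps)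
  also have "\<dots> = pi / c * G w0"
    using integral_gauss_twist_1[OF c, of w0] by simp
  finally show ?thesis .
qed

section \<open>Square integrability for the Gaussian measure\<close>

lemma integrable_gauss_measure_iff:
  fixes f :: "complex \<Rightarrow> 'a::{banach, second_countable_topology}"
  assumes "f \<in> borel_measurable borel"
  shows "integrable gauss_measure f \<longleftrightarrow> integrable lborel (\<lambda>z. (exp (- (cmod z)\<^sup>2) / pi) *\<^sub>R f z)"
  unfolding gauss_measure_def by (rule integrable_density) (use assms in auto)

lemma integral_gauss_measure:
  fixes f :: "complex \<Rightarrow> 'a::{banach, second_countable_topology}"
  assumes "f \<in> borel_measurable borel"
  shows "(\<integral>z. f z \<partial>gauss_measure) = (\<integral>z. (exp (- (cmod z)\<^sup>2) / pi) *\<^sub>R f z \<partial>lborel)"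
  unfolding gauss_measure_def by (rule integral_density) (use assms in auto)

lemma sets_gauss_measure [simp, measurable_cong]: "sets gauss_measure = sets borel"
  by (simp add: gauss_measure_def)

lemma L2_gauss_measurable: "f \<in> L2_gauss \<Longrightarrow> f \<in> borel_measurable borel"
  by (auto simp: L2_gauss_def measurable_cong_sets[OF sets_gauss_measure refl])

text \<open>Half of the Gaussian exponent is attached to \<open>f\<close> before squaring. In this
  form the kernel estimates can be made with respect to Lebesgue measure.\<close>

lemma L2_gauss_iff:
  "f \<in> L2_gauss \<longleftrightarrow> f \<in> borel_measurable borel \<and>
     integrable lborel (\<lambda>z. (cmod (f z) * exp (- (cmod z)\<^sup>2 / 2))\<^sup>2)"
proof -
  have eq: "(exp (- (cmod z)\<^sup>2) / pi) *\<^sub>R (cmod (f z))\<^sup>2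
      = (1 / pi) * (cmod (f z) * exp (- (cmod z)\<^sup>2 / 2))\<^sup>2" for z
    by (simp add: power_mult_distrib exp_double[symmetric])
  have "integrable gauss_measure (\<lambda>z. (cmod (f z))\<^sup>2)
      \<longleftrightarrow> integrable lborel (\<lambda>z. (cmod (f z) * exp (- (cmod z)\<^sup>2 / 2))\<^sup>2)"
    if [measurable]: "f \<in> borel_measurable borel"
  proof -
    have "(\<lambda>z. (cmod (f z))\<^sup>2) \<in> borel_measurable borel"
      by measurable
    from integrable_gauss_measure_iff[OF this] show ?thesis
      unfolding eq integrable_mult_left_iff by simp
  qed
  then show ?thesis
    by (auto simp: L2_gauss_def measurable_cong_sets[OF sets_gauss_measure refl])
qed

section \<open>Translation, convolution kernels and weighted Cauchy-Schwarz\<close>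

lemma lborel_translate:
  fixes f :: "'a::euclidean_space \<Rightarrow> 'b::{banach, second_countable_topology}"
  assumes "integrable lborel f"
  shows integrable_lborel_translate: "integrable lborel (\<lambda>z. f (z - w))"
    and integral_lborel_translate: "(\<integral>z. f (z - w) \<partial>lborel) = (\<integral>z. f z \<partial>lborel)"
proof -
  have [measurable]: "f \<in> borel_measurable borel"
    using assms by auto
  have d: "distr lborel borel (\<lambda>z. z - w) = (lborel :: 'a measure)"
    using lborel_distr_plus[of "- w"] by (simp add: fun_eq_iff[of "(+) _"] cong: distr_cong)
  show "integrable lborel (\<lambda>z. f (z - w))"
    using assms by (subst (asm) d[symmetric]) (simp add: integrable_distr_eq)
  show "(\<integral>z. f (z - w) \<partial>lborel) = (\<integral>z. f z \<partial>lborel)"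
    by (subst (2) d[symmetric]) (simp add: integral_distr)
qed

text \<open>By translation invariance the inner integral of the absolute value is
  \<open>\<bar>q w\<bar>\<close> times a constant. It supports both the Schur test and the exchange
  of integrals for the projection.\<close>

lemma integrable_convolution_kernel:
  fixes q t :: "'a::euclidean_space \<Rightarrow> real"
  assumes q: "integrable lborel q" and t: "integrable lborel t"
  shows "integrable (lborel \<Otimes>\<^sub>M lborel) (\<lambda>(w, z). q w * t (z - w))"
proof (rule lborel_pair.Fubini_integrable)
  have [measurable]: "q \<in> borel_measurable borel" "t \<in> borel_measurable borel"
    using q t by auto
  show "(\<lambda>(w, z). q w * t (z - w)) \<in> borel_measurable (lborel \<Otimes>\<^sub>M lborel)"
    by measurable
  have "(\<integral>z. norm (case (w, z) of (w, z) \<Rightarrow> q w * t (z - w)) \<partial>lborel) = \<bar>q w\<bar> * (\<integral>z. \<bar>t z\<bar> \<partial>lborel)" for w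
    using integral_lborel_translate[OF integrable_norm[OF t], of w] by (simp add: abs_mult)
  then show "integrable lborel (\<lambda>w. \<integral>z. norm (case (w, z) of (w, z) \<Rightarrow> q w * t (z - w)) \<partial>lborel)"
    using integrable_norm[OF q] by simp
  show "AE w in lborel. integrable lborel (\<lambda>z. case (w, z) of (w, z) \<Rightarrow> q w * t (z - w))"
    using integrable_lborel_translate[OF t] by simp
qed

text \<open>This is nonnegativity of a variance for the weight \<open>t\<close>: with total mass
  \<open>E\<close> and first moment \<open>m\<close>, the integral of
  \<open>(E * v - m)\<^sup>2 * t\<close> is \<open>E\<close> times the difference of the two
  sides.\<close>

lemma Cauchy_Schwarz_weighted:
  fixes v t :: "'a \<Rightarrow> real"
  assumes t: "integrable M t" "\<And>x. 0 \<le> t x" "0 < (\<integral>x. t x \<partial>M)"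
    and vt: "integrable M (\<lambda>x. v x * t x)" and v2t: "integrable M (\<lambda>x. (v x)\<^sup>2 * t x)"
  shows "(\<integral>x. v x * t x \<partial>M)\<^sup>2 \<le> (\<integral>x. t x \<partial>M) * (\<integral>x. (v x)\<^sup>2 * t x \<partial>M)"
proof -
  define E m where "E = (\<integral>x. t x \<partial>M)" and "m = (\<integral>x. v x * t x \<partial>M)"
  have "0 \<le> (\<integral>x. (E * v x - m)\<^sup>2 * t x \<partial>M)"
    using t by (intro Bochner_Integration.integral_nonneg) auto
  also have "(\<lambda>x. (E * v x - m)\<^sup>2 * t x)
      = (\<lambda>x. E\<^sup>2 * ((v x)\<^sup>2 * t x) - 2 * E * m * (v x * t x) + m\<^sup>2 * t x)"
    by (simp add: fun_eq_iff power2_eq_square algebra_simps)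
  also have "(\<integral>x. E\<^sup>2 * ((v x)\<^sup>2 * t x) - 2 * E * m * (v x * t x) + m\<^sup>2 * t x \<partial>M)
      = E\<^sup>2 * (\<integral>x. (v x)\<^sup>2 * t x \<partial>M) - 2 * E * m * m + m\<^sup>2 * E"
    using t vt v2t by (simp add: E_def m_def)
  also have "\<dots> = E * (E * (\<integral>x. (v x)\<^sup>2 * t x \<partial>M) - m\<^sup>2)"
    by (simp add: power2_eq_square algebra_simps)
  finally show ?thesis
    using t(3) by (simp add: zero_le_mult_iff E_def m_def)
qed

section \<open>The Gaussian and the reproducing kernel\<close>

lemma integrable_exp_norm_power2:
  "integrable lborel (\<lambda>z::complex. exp (- (cmod z)\<^sup>2 / 2))" (is ?int)
  and integral_exp_norm_power2: "(\<integral>z. exp (- (cmod (z::complex))\<^sup>2 / 2) \<partial>lborel) = 2 * pi" (is ?eq)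
proof -
  have "has_bochner_integral lborel (\<lambda>z::complex. complex_of_real (exp (- (cmod z)\<^sup>2 / 2))) (of_real (2 * pi))"
    using has_bochner_integral_gauss[of "1 / 2"] by (simp add: exp_of_real[symmetric] mult.commute)
  then have "has_bochner_integral lborel (\<lambda>z::complex. exp (- (cmod z)\<^sup>2 / 2)) (2 * pi)"
    using has_bochner_integral_bounded_linear[OF bounded_linear_Re] by fastforce
  then show ?int ?eq by (auto simp: has_bochner_integral_iff)
qed

text \<open>Expanding \<open>(cmod (z - w))\<^sup>2\<close> produces the cross term
  \<open>Re (z * cnj w)\<close>. The weighted kernel thereby becomes a convolution kernel.\<close>

lemma norm_exp_mult_cnj:
  "cmod (exp (z * cnj w)) * exp (- (cmod z)\<^sup>2 / 2) * exp (- (cmod w)\<^sup>2 / 2) = exp (- (cmod (z - w))\<^sup>2 / 2)"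
proof -
  have "(cmod (z - w))\<^sup>2 = (cmod z)\<^sup>2 + (cmod w)\<^sup>2 - 2 * Re (z * cnj w)"
    unfolding cmod_power2 by (simp add: power2_eq_square algebra_simps)
  then show ?thesis by (simp add: exp_add[symmetric] diff_divide_distrib add_divide_distrib)
qed

lemma borel_measurable_cnj [measurable (raw)]:
  "f \<in> borel_measurable M \<Longrightarrow> (\<lambda>x. cnj (f x)) \<in> borel_measurable M"
  by (rule measurable_compose[where N = borel])
     (auto intro: borel_measurable_continuous_onI continuous_intros)

lemma L2_gauss_integrable_mult_cnj:
  assumes f: "f \<in> L2_gauss" and g: "g \<in> L2_gauss"
  shows "integrable gauss_measure (\<lambda>z. f z * cnj (g z))"
proof -
  note [measurable] = L2_gauss_measurable[OF f] L2_gauss_measurable[OF g]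
  have "integrable gauss_measure (\<lambda>z. (cmod (f z))\<^sup>2 + (cmod (g z))\<^sup>2)"
    using f g by (auto simp: L2_gauss_def)
  then show ?thesis
  proof (rule Bochner_Integration.integrable_bound)
    show "AE z in gauss_measure. norm (f z * cnj (g z)) \<le> norm ((cmod (f z))\<^sup>2 + (cmod (g z))\<^sup>2)"
    proof (rule AE_I2)
      fix z
      have "0 \<le> (cmod (f z) - cmod (g z))\<^sup>2 + (cmod (f z))\<^sup>2 + (cmod (g z))\<^sup>2"
        by simp
      then have "2 * (cmod (f z) * cmod (g z)) \<le> 2 * ((cmod (f z))\<^sup>2 + (cmod (g z))\<^sup>2)"
        by (simp add: power2_eq_square algebra_simps)
      then show "norm (f z * cnj (g z)) \<le> norm ((cmod (f z))\<^sup>2 + (cmod (g z))\<^sup>2)"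
        by (simp add: norm_mult)
    qed
  qed measurable
qed

lemma L2_gauss_diff:
  assumes f: "f \<in> L2_gauss" and g: "g \<in> L2_gauss"
  shows "(\<lambda>z. f z - g z) \<in> L2_gauss"
proof -
  note [measurable] = L2_gauss_measurable[OF f] L2_gauss_measurable[OF g]
  have "integrable gauss_measure (\<lambda>z. 2 * (cmod (f z))\<^sup>2 + 2 * (cmod (g z))\<^sup>2)"
    using f g by (auto simp: L2_gauss_def)
  then have "integrable gauss_measure (\<lambda>z. (cmod (f z - g z))\<^sup>2)"
  proof (rule Bochner_Integration.integrable_bound)
    show "AE z in gauss_measure. norm ((cmod (f z - g z))\<^sup>2) \<le> norm (2 * (cmod (f z))\<^sup>2 + 2 * (cmod (g z))\<^sup>2)"
    proof (rule AE_I2)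
      fix z
      have "(cmod (f z - g z))\<^sup>2 \<le> (cmod (f z) + cmod (g z))\<^sup>2"
        by (intro power_mono norm_triangle_ineq4) simp
      also have "\<dots> \<le> 2 * (cmod (f z))\<^sup>2 + 2 * (cmod (g z))\<^sup>2"
        using zero_le_power2[of "cmod (f z) - cmod (g z)"] by (simp add: power2_eq_square algebra_simps)
      finally show "norm ((cmod (f z - g z))\<^sup>2) \<le> norm (2 * (cmod (f z))\<^sup>2 + 2 * (cmod (g z))\<^sup>2)"
        by simp
    qed
  qed measurable
  then show ?thesis
    by (auto simp: L2_gauss_def)
qed

text \<open>Up to a constant depending on \<open>z\<close>, the weighted kernel is a Gaussian
  centred at \<open>z\<close>, so translation gives integrability of its square.\<close>

lemma exp_mult_cnj_L2_gauss: "(\<lambda>w. exp (cnj z * w)) \<in> L2_gauss"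
proof -
  have "(\<lambda>w. exp (cnj z * w)) \<in> borel_measurable borel"
    by (intro borel_measurable_continuous_onI continuous_intros)
  moreover have "(cmod (exp (cnj z * w)) * exp (- (cmod w)\<^sup>2 / 2))\<^sup>2 = exp ((cmod z)\<^sup>2) * (exp (- (cmod (w - z))\<^sup>2 / 2))\<^sup>2" for w
  proof -
    have "exp ((cmod z)\<^sup>2) * (exp (- (cmod z)\<^sup>2 / 2))\<^sup>2 = 1"
      by (simp add: exp_double[symmetric] exp_add[symmetric])
    moreover have "(x * y)\<^sup>2 = a * (x * y * b)\<^sup>2" if "a * b\<^sup>2 = 1" for a b x y :: real
      using that by algebra
    ultimately show ?thesis
      unfolding norm_exp_mult_cnj[of w z, symmetric] mult.commute[of "cnj z"] by blast
  qed
  moreover have "integrable lborel (\<lambda>w. exp ((cmod z)\<^sup>2) * (exp (- (cmod (w - z))\<^sup>2 / 2))\<^sup>2)"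
  proof -
    have "integrable lborel (\<lambda>w::complex. (exp (- (cmod w)\<^sup>2 / 2))\<^sup>2)"
      by (rule Bochner_Integration.integrable_bound[OF integrable_exp_norm_power2])
         (auto simp: power_le_one power2_eq_square mult_left_le_one_le)
    from integrable_lborel_translate[OF this, of z] show ?thesis by simp
  qed
  ultimately show ?thesis by (simp add: L2_gauss_iff)
qed

lemma L2_gauss_integrable_kernel:
  "u \<in> L2_gauss \<Longrightarrow> integrable gauss_measure (\<lambda>w. u w * exp (z * cnj w))"
  using L2_gauss_integrable_mult_cnj[OF _ exp_mult_cnj_L2_gauss[of z], of u] by (simp add: exp_cnj)

text \<open>The density and the kernel merge into the twisted Gaussian with \<open>c = 1\<close> and
  centre \<open>w\<close>; the kernel lies in \<open>L2_gauss\<close>, which supplies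
  integrability.\<close>

lemma fock_reproducing:
  assumes "k \<in> fock"
  shows "(\<integral>z. k z * exp (w * cnj z) \<partial>gauss_measure) = k w"
proof -
  have k: "k \<in> L2_gauss" "k holomorphic_on UNIV"
    using assms by (auto simp: fock_def)
  note [measurable] = L2_gauss_measurable[OF k(1)]
  have meas: "(\<lambda>z. k z * exp (w * cnj z)) \<in> borel_measurable borel"
    by (intro borel_measurable_continuous_onI continuous_intros holomorphic_on_imp_continuous_on k)
  have eq: "(exp (- (cmod z)\<^sup>2) / pi) *\<^sub>R (k z * exp (w * cnj z)) = 1 / pi * (exp (- 1 * cnj z * (z - w)) * k z)" for z
  proof -
    have "- 1 * cnj z * (z - w) = of_real (- (cmod z)\<^sup>2) + w * cnj z"
      by (simp only: of_real_minus complex_norm_square) (simp add: algebra_simps)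
    then have "exp (- 1 * cnj z * (z - w)) = of_real (exp (- (cmod z)\<^sup>2)) * exp (w * cnj z)"
      by (simp only: exp_add exp_of_real)
    then show ?thesis by (simp add: scaleR_conv_of_real)
  qed
  have "integrable lborel (\<lambda>z. 1 / pi * (exp (- 1 * cnj z * (z - w)) * k z))"
    using L2_gauss_integrable_kernel[OF k(1), of w] unfolding integrable_gauss_measure_iff[OF meas] eq .
  from integrable_mult_right[OF this, of pi]
  have "integrable lborel (\<lambda>z. exp (- 1 * cnj z * (z - w)) * k z)"
    by simp
  from integral_gauss_twist[OF _ k(2) this]
  have "(\<integral>z. exp (- 1 * cnj z * (z - w)) * k z \<partial>lborel) = pi * k w"
    by simp
  then show ?thesis
    unfolding integral_gauss_measure[OF meas] eq by (simp del: mult_minus_left)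
qed

section \<open>The kernel integral as orthogonal projection\<close>

text \<open>Schur test: with half weights attached, \<open>h\<close> is bounded by the convolution
  of \<open>v\<close> with \<open>t\<close>, divided by \<open>pi\<close>. Cauchy-Schwarz with
  weight \<open>t\<close> moves the square onto \<open>v\<close>, and the convolution of two
  integrable functions is integrable.\<close>

lemma kernel_integral_L2_gauss:
  assumes u: "u \<in> L2_gauss" and h: "h \<in> borel_measurable borel"
    and h_eq: "\<And>z. h z = (\<integral>w. u w * exp (z * cnj w) \<partial>gauss_measure)"
  shows "h \<in> L2_gauss"
proof -
  note [measurable] = L2_gauss_measurable[OF u] h
  define v where "v w = cmod (u w) * exp (- (cmod w)\<^sup>2 / 2)" for w
  define t where "t z = exp (- (cmod z)\<^sup>2 / 2)" for z :: complex
  have [measurable]: "v \<in> borel_measurable borel" "t \<in> borel_measurable borel"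
    unfolding v_def t_def by measurable
  have t01: "0 \<le> t z" "t z \<le> 1" for z by (auto simp: t_def)
  have v2: "integrable lborel (\<lambda>w. (v w)\<^sup>2)"
    using u by (simp add: L2_gauss_iff v_def)
  have tint: "integrable lborel t" "(\<integral>z. t z \<partial>lborel) = 2 * pi"
    unfolding t_def by (rule integrable_exp_norm_power2 integral_exp_norm_power2)+
  have t_sym: "t (z - w) = t (w - z)" for z w by (simp add: t_def norm_minus_commute)
  have tz: "integrable lborel (\<lambda>w. t (z - w))" "(\<integral>w. t (z - w) \<partial>lborel) = 2 * pi" for z
    using lborel_translate[OF tint(1), of z] tint by (simp_all add: t_sym[of z])
  have v2t: "integrable lborel (\<lambda>w. (v w)\<^sup>2 * t (z - w))" for z
    by (rule Bochner_Integration.integrable_bound[OF v2])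
       (use t01 in \<open>auto intro!: mult_right_le_one_le\<close>)
  have vt: "integrable lborel (\<lambda>w. v w * t (z - w))" for z
  proof (rule Bochner_Integration.integrable_bound[OF Bochner_Integration.integrable_add[OF v2t tz(1)]])
    show "AE w in lborel. norm (v w * t (z - w)) \<le> norm ((v w)\<^sup>2 * t (z - w) + t (z - w))"
    proof (rule AE_I2)
      fix w
      have "0 \<le> (\<bar>v w\<bar> - 1)\<^sup>2 + \<bar>v w\<bar>"
        by simp
      then have "\<bar>v w\<bar> \<le> (v w)\<^sup>2 + 1"
        by (simp add: power2_eq_square algebra_simps)
      then have "\<bar>v w\<bar> * t (z - w) \<le> ((v w)\<^sup>2 + 1) * t (z - w)"
        by (rule mult_right_mono) (rule t01)
      then show "norm (v w * t (z - w)) \<le> norm ((v w)\<^sup>2 * t (z - w) + t (z - w))"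
        using t01 by (simp add: abs_mult algebra_simps)
    qed
  qed measurable
  \<comment> \<open>The constant is the mass \<open>2 * pi\<close> of \<open>t\<close> over
    \<open>pi\<^sup>2\<close>, the square of the normalisation of the measure.\<close>
  have bound: "(cmod (h z) * exp (- (cmod z)\<^sup>2 / 2))\<^sup>2 \<le> 2 / pi * (\<integral>w. (v w)\<^sup>2 * t (z - w) \<partial>lborel)" for z
  proof -
    have meas: "(\<lambda>w. u w * exp (z * cnj w)) \<in> borel_measurable borel"
      by measurable
    have kernel: "exp (- (cmod z)\<^sup>2 / 2) * norm ((exp (- (cmod w)\<^sup>2) / pi) *\<^sub>R (u w * exp (z * cnj w)))
        = v w * t (z - w) / pi" for w
    proof -
      have "exp (- (cmod w)\<^sup>2) = exp (- (cmod w)\<^sup>2 / 2) * exp (- (cmod w)\<^sup>2 / 2)"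
        by (simp add: exp_add[symmetric])
      then show ?thesis
        unfolding v_def t_def norm_exp_mult_cnj[symmetric]
        by (simp add: norm_mult mult_ac)
    qed
    have "cmod (h z) \<le> (\<integral>w. norm ((exp (- (cmod w)\<^sup>2) / pi) *\<^sub>R (u w * exp (z * cnj w))) \<partial>lborel)"
      unfolding h_eq integral_gauss_measure[OF meas] by (rule integral_norm_bound)
    then have "exp (- (cmod z)\<^sup>2 / 2) * cmod (h z)
        \<le> exp (- (cmod z)\<^sup>2 / 2) * (\<integral>w. norm ((exp (- (cmod w)\<^sup>2) / pi) *\<^sub>R (u w * exp (z * cnj w))) \<partial>lborel)"
      by (rule mult_left_mono) simp
    also have "\<dots> = (\<integral>w. v w * t (z - w) / pi \<partial>lborel)"
      unfolding integral_mult_right_zero[symmetric] kernel ..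
    finally have "cmod (h z) * exp (- (cmod z)\<^sup>2 / 2) \<le> (\<integral>w. v w * t (z - w) \<partial>lborel) / pi"
      by (simp add: mult.commute)
    then have "(cmod (h z) * exp (- (cmod z)\<^sup>2 / 2))\<^sup>2 \<le> ((\<integral>w. v w * t (z - w) \<partial>lborel) / pi)\<^sup>2"
      by (rule power_mono) simp
    also have "\<dots> = (\<integral>w. v w * t (z - w) \<partial>lborel)\<^sup>2 / pi\<^sup>2"
      by (rule power_divide)
    also have "\<dots> \<le> (2 * pi * (\<integral>w. (v w)\<^sup>2 * t (z - w) \<partial>lborel)) / pi\<^sup>2"
      using Cauchy_Schwarz_weighted[OF tz(1) _ _ vt v2t, of z] t01 tz(2)
      by (intro divide_right_mono) auto
    also have "\<dots> = 2 / pi * (\<integral>w. (v w)\<^sup>2 * t (z - w) \<partial>lborel)"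
      by (simp add: power2_eq_square)
    finally show ?thesis .
  qed
  have "integrable lborel (\<lambda>z. \<integral>w. (v w)\<^sup>2 * t (z - w) \<partial>lborel)"
    by (rule lborel_pair.integrable_snd[OF integrable_convolution_kernel[OF v2 tint(1)]])
  then have "integrable lborel (\<lambda>z. 2 / pi * (\<integral>w. (v w)\<^sup>2 * t (z - w) \<partial>lborel))"
    by (rule integrable_mult_right)
  then have "integrable lborel (\<lambda>z. (cmod (h z) * exp (- (cmod z)\<^sup>2 / 2))\<^sup>2)"
    by (rule Bochner_Integration.integrable_bound)
       (use order_trans[OF bound abs_ge_self] in \<open>auto intro!: AE_I2\<close>)
  then show ?thesis
    using h by (simp add: L2_gauss_iff)
qed

text \<open>Exchanging the integrals lets the kernel act on \<open>k\<close> instead of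
  \<open>u\<close>, where it reproduces \<open>k\<close>. Consequently \<open>u - h\<close> is
  orthogonal to \<open>fock\<close>.\<close>

lemma L2_inner_kernel_integral:
  assumes u: "u \<in> L2_gauss" and h: "h \<in> borel_measurable borel"
    and h_eq: "\<And>z. h z = (\<integral>w. u w * exp (z * cnj w) \<partial>gauss_measure)"
    and k: "k \<in> fock"
  shows "L2_inner h k = L2_inner u k"
proof -
  have kL: "k \<in> L2_gauss" using k by (simp add: fock_def)
  note [measurable] = L2_gauss_measurable[OF u] h L2_gauss_measurable[OF kL]
  define v where "v u w = cmod (u w) * exp (- (cmod w)\<^sup>2 / 2)" for u :: "complex \<Rightarrow> complex" and w
  define t where "t z = exp (- (cmod z)\<^sup>2 / 2)" for z :: complex
  define g where "g z = exp (- (cmod z)\<^sup>2) / pi" for z :: complex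
  \<comment> \<open>Both densities are put into the integrand, so that Fubini is applied to Lebesgue
    measure. Its modulus is dominated by convolution kernels built from the squares of
    \<open>v u\<close> and \<open>v k\<close>.\<close>
  define f where "f w z = (g w * g z) *\<^sub>R (u w * exp (z * cnj w) * cnj (k z))" for w z
  have [measurable]: "v u \<in> borel_measurable borel" "v k \<in> borel_measurable borel"
     "t \<in> borel_measurable borel" "g \<in> borel_measurable borel"
    unfolding v_def t_def g_def by measurable
  have tint: "integrable lborel t"
    unfolding t_def by (rule integrable_exp_norm_power2)
  have uv: "integrable lborel (\<lambda>w. (v u w)\<^sup>2)" and kv: "integrable lborel (\<lambda>w. (v k w)\<^sup>2)"
    using u kL by (simp_all add: L2_gauss_iff v_def)
  have t_sym: "t (z - w) = t (w - z)" for z w by (simp add: t_def norm_minus_commute)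
  have "integrable (lborel \<Otimes>\<^sub>M lborel) (\<lambda>(z, w). (v k z)\<^sup>2 * t (w - z))"
    by (rule integrable_convolution_kernel[OF kv tint])
  from lborel_pair.integrable_product_swap[OF this]
  have 2: "integrable (lborel \<Otimes>\<^sub>M lborel) (\<lambda>(w, z). (v k z)\<^sup>2 * t (z - w))"
    by (simp add: t_sym)
  have norm_f: "norm (f w z) = v u w * v k z * t (z - w) / pi\<^sup>2" for w z
  proof -
    have "exp (- (cmod x)\<^sup>2) = exp (- (cmod x)\<^sup>2 / 2) * exp (- (cmod x)\<^sup>2 / 2)" for x :: complex
      by (simp add: exp_add[symmetric])
    then show ?thesis
      unfolding v_def t_def f_def g_def norm_exp_mult_cnj[symmetric]
      by (simp add: norm_mult power2_eq_square mult_ac)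
  qed
  have f: "integrable (lborel \<Otimes>\<^sub>M lborel) (case_prod f)"
  proof (rule Bochner_Integration.integrable_bound)
    show "integrable (lborel \<Otimes>\<^sub>M lborel)
        (\<lambda>x. (case x of (w, z) \<Rightarrow> (v u w)\<^sup>2 * t (z - w)) + (case x of (w, z) \<Rightarrow> (v k z)\<^sup>2 * t (z - w)))"
      by (intro Bochner_Integration.integrable_add 2 integrable_convolution_kernel uv tint)
    show "case_prod f \<in> borel_measurable (lborel \<Otimes>\<^sub>M lborel)"
      unfolding f_def by measurable
    have "norm (f w z) \<le> (v u w)\<^sup>2 * t (z - w) + (v k z)\<^sup>2 * t (z - w)" for w z
    proof -
      have v0: "0 \<le> v u w" "0 \<le> v k z" and t0: "0 \<le> t (z - w)"
        by (auto simp: v_def t_def)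
      have "1 \<le> pi\<^sup>2" using pi_gt3 by (simp add: one_le_power)
      then have "v u w * v k z * t (z - w) / pi\<^sup>2 \<le> v u w * v k z * t (z - w) / 1"
        using v0 t0 by (intro divide_left_mono) auto
      also have "v u w * v k z \<le> (v u w)\<^sup>2 + (v k z)\<^sup>2"
      proof -
        have "x * y \<le> x\<^sup>2 + y\<^sup>2" if "0 \<le> x" "0 \<le> y" for x y :: real
        proof -
          have "2 * x * y \<le> x\<^sup>2 + y\<^sup>2" "0 \<le> x * y"
            using sum_squares_bound[of x y] that by simp_all
          then show ?thesis by linarith
        qed
        then show ?thesis using v0 .
      qed
      then have "v u w * v k z * t (z - w) / 1 \<le> ((v u w)\<^sup>2 + (v k z)\<^sup>2) * t (z - w)"
        unfolding div_by_1 using t0 by (rule mult_right_mono)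
      finally show ?thesis by (simp add: norm_f algebra_simps)
    qed
    note order_trans[OF this abs_ge_self]
    then show "AE x in lborel \<Otimes>\<^sub>M lborel. norm (case_prod f x)
        \<le> norm ((case x of (w, z) \<Rightarrow> (v u w)\<^sup>2 * t (z - w)) + (case x of (w, z) \<Rightarrow> (v k z)\<^sup>2 * t (z - w)))"
      by (auto intro!: AE_I2)
  qed
  have int_w: "(\<integral>w. f w z \<partial>lborel) = g z *\<^sub>R (h z * cnj (k z))" for z
  proof -
    have "(\<lambda>w. u w * exp (z * cnj w)) \<in> borel_measurable borel"
      by measurable
    then have "h z = (\<integral>w. g w *\<^sub>R (u w * exp (z * cnj w)) \<partial>lborel)"
      unfolding g_def h_eq by (rule integral_gauss_measure)
    then have "(g z *\<^sub>R cnj (k z)) * h z = (\<integral>w. (g z *\<^sub>R cnj (k z)) * (g w *\<^sub>R (u w * exp (z * cnj w))) \<partial>lborel)"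
      by (simp only: integral_mult_right_zero)
    also have "(\<lambda>w. (g z *\<^sub>R cnj (k z)) * (g w *\<^sub>R (u w * exp (z * cnj w)))) = (\<lambda>w. f w z)"
      by (simp add: f_def fun_eq_iff scaleR_conv_of_real mult_ac)
    finally show ?thesis by (simp add: mult.commute)
  qed
  have int_z: "(\<integral>z. f w z \<partial>lborel) = g w *\<^sub>R (u w * cnj (k w))" for w
  proof -
    have "(\<lambda>z. k z * exp (w * cnj z)) \<in> borel_measurable borel"
      by measurable
    from integral_gauss_measure[OF this]
    have "cnj (k w) = (\<integral>z. cnj (g z *\<^sub>R (k z * exp (w * cnj z))) \<partial>lborel)"
      unfolding g_def fock_reproducing[OF k] Bochner_Integration.integral_cnj by simp
    then have "(g w *\<^sub>R u w) * cnj (k w) = (\<integral>z. (g w *\<^sub>R u w) * cnj (g z *\<^sub>R (k z * exp (w * cnj z))) \<partial>lborel)"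
      by (simp only: integral_mult_right_zero)
    also have "(\<lambda>z. (g w *\<^sub>R u w) * cnj (g z *\<^sub>R (k z * exp (w * cnj z)))) = (\<lambda>z. f w z)"
      by (simp add: f_def fun_eq_iff scaleR_conv_of_real exp_cnj mult_ac)
    finally show ?thesis by simp
  qed
  have "L2_inner h k = (\<integral>z. g z *\<^sub>R (h z * cnj (k z)) \<partial>lborel)"
    unfolding L2_inner_def g_def by (rule integral_gauss_measure) measurable
  also have "\<dots> = (\<integral>w. g w *\<^sub>R (u w * cnj (k w)) \<partial>lborel)"
    using lborel_pair.Fubini_integral[OF f] by (simp add: int_w int_z)
  also have "\<dots> = L2_inner u k"
    unfolding L2_inner_def g_def by (rule integral_gauss_measure[symmetric]) measurable
  finally show ?thesis .
qed

text \<open>The density is positive, so \<open>d\<close> vanishes almost everywhere for Lebesgue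
  measure. By continuity its nonzero set is open, and a nonempty open set is not null.\<close>

lemma fock_eq_0:
  assumes d: "d \<in> fock" and "L2_inner d d = 0"
  shows "d z = 0"
proof (rule ccontr)
  assume "d z \<noteq> 0"
  have dL: "d \<in> L2_gauss" and cont: "continuous_on UNIV d"
    using d by (auto simp: fock_def intro: holomorphic_on_imp_continuous_on)
  note [measurable] = L2_gauss_measurable[OF dL]
  have "complex_of_real (\<integral>z. (cmod (d z))\<^sup>2 \<partial>gauss_measure) = 0"
    using assms(2) unfolding L2_inner_def complex_norm_square[symmetric] integral_complex_of_real .
  then have "AE z in gauss_measure. (cmod (d z))\<^sup>2 = 0"
    using dL by (subst integral_nonneg_eq_0_iff_AE[symmetric]) (auto simp: L2_gauss_def)
  then have "AE z in lborel. d z = 0"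
    unfolding gauss_measure_def by (subst (asm) AE_density) auto
  then have "{z. d z \<noteq> 0} \<in> null_sets lborel"
    using AE_iff_null_sets[of "{z. d z \<noteq> 0}" lborel] by simp
  moreover have "open {z. d z \<noteq> 0}"
    using cont by (intro open_Collect_neq) auto
  ultimately show False
    using \<open>d z \<noteq> 0\<close> open_not_negligible[of "{z. d z \<noteq> 0}"]
    by (auto simp: negligible_iff_null_sets null_sets_completionI)
qed

lemma fock_diff: "f \<in> fock \<Longrightarrow> g \<in> fock \<Longrightarrow> (\<lambda>z. f z - g z) \<in> fock"
  by (auto simp: fock_def intro: L2_gauss_diff holomorphic_on_diff)

lemma L2_inner_diff_left:
  assumes "f \<in> L2_gauss" "g \<in> L2_gauss" "k \<in> L2_gauss"
  shows "L2_inner (\<lambda>z. f z - g z) k = L2_inner f k - L2_inner g k"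
  using Bochner_Integration.integral_diff
    [OF L2_gauss_integrable_mult_cnj[OF assms(1,3)] L2_gauss_integrable_mult_cnj[OF assms(2,3)]]
  unfolding L2_inner_def left_diff_distrib .

text \<open>Membership comes from the Schur test and orthogonality from the exchange of integrals.
  For uniqueness, the difference of two candidates is in \<open>fock\<close> and orthogonal to
  itself. Thus the description in \<open>fock_proj\<close> is satisfied by exactly one
  function.\<close>

lemma fock_proj_eqI:
  assumes u: "u \<in> L2_gauss" and hol: "h holomorphic_on UNIV"
    and h_eq: "\<And>z. h z = (\<integral>w. u w * exp (z * cnj w) \<partial>gauss_measure)"
  shows "h \<in> fock" and "fock_proj u = h"
proof -
  have meas: "h \<in> borel_measurable borel"
    using hol by (intro borel_measurable_continuous_onI holomorphic_on_imp_continuous_on)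
  show h: "h \<in> fock"
    using kernel_integral_L2_gauss[OF u meas h_eq] hol by (simp add: fock_def)
  have fockL: "k \<in> L2_gauss" if "k \<in> fock" for k
    using that by (simp add: fock_def)
  have orth: "L2_inner (\<lambda>z. u z - h z) k = 0" if "k \<in> fock" for k
    using L2_inner_diff_left[OF u fockL[OF h] fockL[OF that]] L2_inner_kernel_integral[OF u meas h_eq that]
    by simp
  show "fock_proj u = h"
    unfolding fock_proj_def
  proof (rule the_equality)
    show "h \<in> fock \<and> (\<forall>k\<in>fock. L2_inner (\<lambda>z. u z - h z) k = 0)"
      using h orth by blast
    fix h'
    assume h': "h' \<in> fock \<and> (\<forall>k\<in>fock. L2_inner (\<lambda>z. u z - h' z) k = 0)"
    define d where "d = (\<lambda>z. h z - h' z)"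
    have d: "d \<in> fock"
      unfolding d_def using h h' by (intro fock_diff) auto
    have "L2_inner d d = L2_inner (\<lambda>z. u z - h' z) d - L2_inner (\<lambda>z. u z - h z) d"
      using u h h' d fockL by (simp add: L2_inner_diff_left d_def[symmetric])
         (simp add: d_def L2_inner_diff_left fock_diff fockL)
    also have "\<dots> = 0"
      using h' orth d by simp
    finally show "h' = h"
      using fock_eq_0[OF d] by (auto simp: d_def fun_eq_iff)
  qed
qed

section \<open>Identification with the Toeplitz operator\<close>

text \<open>The disc condition says \<open>(cmod l)\<^sup>2 \<le> Re l\<close>, and
  \<open>Re (1 / l)\<close> is \<open>Re l / (cmod l)\<^sup>2\<close>. This gives the Gaussian
  decay.\<close>

lemma Re_inverse_pos_of_disc:
  fixes l :: complex
  assumes "cmod (l - 1 / 2) \<le> 1 / 2" "l \<noteq> 0"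
  shows "Re (1 / l) > 0"
proof -
  have "(cmod (l - 1 / 2))\<^sup>2 \<le> (1 / 2)\<^sup>2"
    using assms(1) by (intro power_mono) auto
  then have "(cmod l)\<^sup>2 \<le> Re l"
    unfolding cmod_power2 by (simp add: power2_eq_square algebra_simps)
  moreover have "0 < (cmod l)\<^sup>2"
    using assms(2) by simp
  ultimately show ?thesis
    by (simp add: Re_divide cmod_power2)
qed

theorem theorem3p12:
  fixes a l :: complex and \<phi> \<psi> :: "complex \<Rightarrow> complex"
  assumes "\<And>z. \<phi> z = a + l * z"
    and "cmod (l - 1 / 2) \<le> 1 / 2" and "l \<noteq> 0" and "l \<noteq> 1"
    and "\<psi> \<in> fock"
    and "bounded (range (symbol \<psi> a l))"
  shows "\<forall>g\<in>fock. weighted_comp \<psi> \<phi> g \<in> fock \<and> weighted_comp \<psi> \<phi> g = toeplitz (symbol \<psi> a l) g"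
proof
  fix g
  assume "g \<in> fock"
  then have gL: "g \<in> L2_gauss" and gh: "g holomorphic_on UNIV"
    by (auto simp: fock_def)
  have ph: "\<psi> holomorphic_on UNIV"
    using assms(5) by (simp add: fock_def)
  define s where "s = symbol \<psi> a l"
  define c where "c = 1 / l"
  define u where "u = (\<lambda>w. s w * g w)"
  define G where "G w = \<psi> ((w - a) / l) * g w" for w
  define h where "h = weighted_comp \<psi> \<phi> g"
  have c: "Re c > 0"
    unfolding c_def using assms(2,3) by (rule Re_inverse_pos_of_disc)
  then have c0: "c \<noteq> 0" by auto
  have Gh: "G holomorphic_on UNIV"
    unfolding G_def using assms(3)
    by (intro holomorphic_intros gh holomorphic_on_compose_gen[OF _ ph, unfolded o_def]) auto
  have hh: "h holomorphic_on UNIV"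
    unfolding h_def weighted_comp_def assms(1)
    by (intro holomorphic_intros ph holomorphic_on_compose_gen[OF _ gh, unfolded o_def]) auto
  have s_cont: "continuous_on UNIV s"
    unfolding s_def symbol_def
    by (intro continuous_intros continuous_on_compose2[OF holomorphic_on_imp_continuous_on[OF ph]])
       (use assms(3) in auto)
  have [measurable]: "g \<in> borel_measurable borel" "s \<in> borel_measurable borel"
    using gL L2_gauss_measurable s_cont by (auto intro: borel_measurable_continuous_onI)
  obtain B where B: "\<And>w. cmod (s w) \<le> B"
    using assms(6) by (auto simp: bounded_iff s_def)
  \<comment> \<open>Boundedness of the symbol enters here, to bring \<open>s * g\<close> into the
    domain of the projection.\<close>
  have u: "u \<in> L2_gauss"
  proof -
    have "integrable gauss_measure (\<lambda>z. B\<^sup>2 * (cmod (g z))\<^sup>2)"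
      using gL by (auto simp: L2_gauss_def)
    then have "integrable gauss_measure (\<lambda>z. (cmod (u z))\<^sup>2)"
    proof (rule Bochner_Integration.integrable_bound)
      show "AE z in gauss_measure. norm ((cmod (u z))\<^sup>2) \<le> norm (B\<^sup>2 * (cmod (g z))\<^sup>2)"
        using B by (auto simp: u_def norm_mult power_mult_distrib intro!: AE_I2 mult_right_mono power_mono)
    qed (simp add: u_def)
    then show ?thesis by (simp add: L2_gauss_def u_def)
  qed
  have "h z = (\<integral>w. u w * exp (z * cnj w) \<partial>gauss_measure)" for z
  proof -
    define w0 where "w0 = a + l * z"
    have meas: "(\<lambda>w. u w * exp (z * cnj w)) \<in> borel_measurable borel"
      unfolding u_def by measurable
    \<comment> \<open>The coefficients of \<open>(cmod w)\<^sup>2\<close> add up to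
      \<open>-1 + (l - 1) / l = - c\<close>, and the terms in \<open>cnj w\<close> to
      \<open>a / l + z = c * w0\<close>; hence the centre \<open>w0 = a + l * z\<close>.\<close>
    have eq: "(exp (- (cmod w)\<^sup>2) / pi) *\<^sub>R (u w * exp (z * cnj w))
        = c / pi * (exp (- c * cnj w * (w - w0)) * G w)" for w
    proof -
      have "- c * cnj w * (w - w0) = of_real (- (cmod w)\<^sup>2)
          + (((l - 1) / l * of_real ((cmod w)\<^sup>2) + a * cnj w / l) + z * cnj w)"
        using assms(3) by (simp only: of_real_minus complex_norm_square c_def w0_def) (simp add: field_simps)
      then have "exp (- c * cnj w * (w - w0)) = of_real (exp (- (cmod w)\<^sup>2))
          * (exp ((l - 1) / l * of_real ((cmod w)\<^sup>2) + a * cnj w / l) * exp (z * cnj w))"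
        by (simp only: exp_add exp_of_real)
      then show ?thesis
        by (simp add: u_def s_def symbol_def G_def c_def scaleR_conv_of_real mult_ac del: of_real_power)
    qed
    have "integrable lborel (\<lambda>w. c / pi * (exp (- c * cnj w * (w - w0)) * G w))"
      using L2_gauss_integrable_kernel[OF u, of z] unfolding integrable_gauss_measure_iff[OF meas] eq .
    from integrable_mult_right[OF this, of "pi / c"]
    have "integrable lborel (\<lambda>w. exp (- c * cnj w * (w - w0)) * G w)"
      using c0 by simp
    from integral_gauss_twist[OF c Gh this]
    have "(\<integral>w. u w * exp (z * cnj w) \<partial>gauss_measure) = c / pi * (pi / c * G w0)"
      unfolding integral_gauss_measure[OF meas] eq by (simp only: integral_mult_right_zero)
    \<comment> \<open>At the centre \<open>(w0 - a) / l = z\<close> and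
      \<open>w0 = \<phi> z\<close>, so \<open>G w0\<close> is the weighted composition at
      \<open>z\<close>; the prefactor \<open>1 / l\<close> of the symbol cancels the
      \<open>1 / c\<close> from the integral.\<close>
    also have "\<dots> = h z"
      using c assms(3) by (auto simp: G_def h_def weighted_comp_def assms(1) w0_def)
    finally show ?thesis ..
  qed
  from fock_proj_eqI[OF u hh this]
  show "weighted_comp \<psi> \<phi> g \<in> fock \<and> weighted_comp \<psi> \<phi> g = toeplitz (symbol \<psi> a l) g"
    by (simp add: toeplitz_def h_def u_def s_def)
qed

end
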